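(* Let $q$ be a polynomial on $\mathbf{R}$ with real coefficients and degree $m \geq 2$, and let $s, \theta > 0$. Define the operator $T$ by $(Tf)(x) = e^{i q(x)} f(x)$, $x \in \mathbf{R}$. If $$1 \leq s < \theta m - \max(\theta, 1),$$ and $\theta \geq 1$ if $m = 3$, then $T \mathcal{S}_\theta^s(\mathbf{R}) \nsubseteq \mathcal{S}_\theta^s(\mathbf{R})$.
   Context: Notation: $\mathbf{N} = \{0,1,2,\dots\}$, $D = i^{-1}\frac{d}{dx}$. For $\theta, s, h > 0$, $\mathcal{S}_{\theta,h}^s(\mathbf{R})$ is the space of all $f \in C^\infty(\mathbf{R})$ such that $$\sup_{\alpha,\beta \in \mathbf{N},\ x \in \mathbf{R}} \frac{|x^\alpha D^\beta f(x)|}{h^{\alpha+\beta}\, \alpha!^\theta\, \beta!^s} < \infty.$$ The Roumieu type Gelfand--Shilov space is $\mathcal{S}_\theta^s(\mathbf{R}) = \bigcup_{h>0} \mathcal{S}_{\theta,h}^s(\mathbf{R})$. *)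

theory Defs
  imports "HOL-Analysis.Analysis" "HOL-Computational_Algebra.Polynomial"
begin

definition smooth_fun :: "(real \<Rightarrow> complex) \<Rightarrow> bool" where
  "smooth_fun f \<longleftrightarrow>
     (\<forall>n x. ((\<lambda>g t. vector_derivative g (at t)) ^^ n) f differentiable (at x))"

definition D_op :: "(real \<Rightarrow> complex) \<Rightarrow> real \<Rightarrow> complex" where
  "D_op f = (\<lambda>x. inverse \<i> * vector_derivative f (at x))"

text \<open>In the following two definitions the parameters are meant to be positive. A finite
  supremum of real quantities is expressed by boundedness from above.\<close>

definition gelfand_shilov_h :: "real \<Rightarrow> real \<Rightarrow> real \<Rightarrow> (real \<Rightarrow> complex) set" where
  "gelfand_shilov_h \<theta> s h = {f. smooth_fun f \<and>
     bdd_above {cmod (complex_of_real (x ^ \<alpha>) * (D_op ^^ \<beta>) f x)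
                  / (h ^ (\<alpha> + \<beta>) * (fact \<alpha>) powr \<theta> * (fact \<beta>) powr s)
                | (\<alpha>::nat) (\<beta>::nat) (x::real). True}}"

definition gelfand_shilov :: "real \<Rightarrow> real \<Rightarrow> (real \<Rightarrow> complex) set" where
  "gelfand_shilov \<theta> s = (\<Union>h\<in>{0<..}. gelfand_shilov_h \<theta> s h)"

definition chirp_op :: "real poly \<Rightarrow> (real \<Rightarrow> complex) \<Rightarrow> real \<Rightarrow> complex" where
  "chirp_op q f = (\<lambda>x. exp (\<i> * complex_of_real (poly q x)) * f x)"

end

theory Submission
  imports Defs "HOL-Complex_Analysis.Complex_Analysis"
begin

text \<open>
  The witness is \<open>f x = exp (- ((1 + x\<^sup>2) powr (1 / (2 * \<theta>))))\<close>. Up to constant factors in the exponent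
  it decays exactly like \<open>exp (- (\<bar>x\<bar> powr (1 / \<theta>)))\<close>, and it extends holomorphically, with the same kind of decay, to a
  strip around the real line. By Cauchy's inequality it therefore satisfies the estimates with
  \<open>s = 1\<close>, and hence with every \<open>s \<ge> 1\<close> (\<open>bracket_exp_in_gelfand_shilov\<close>).

  Multiplication by the chirp \<open>exp (\<i> * q)\<close> makes \<open>f\<close> oscillate near a large point \<open>x\<close> with frequency
  about \<open>q' x\<close>, so the \<open>n\<close>-th derivative of the product \<open>g\<close> at \<open>x\<close> should have size
  \<open>\<bar>q' x\<bar> ^ n * \<bar>f x\<bar>\<close>, where \<open>\<bar>q' x\<bar>\<close> is comparable to \<open>x ^ (m - 1)\<close>. At \<open>x = n powr \<theta>\<close> the factor
  \<open>\<bar>f x\<bar>\<close> costs only \<open>exp (- O(n))\<close>, and the derivative is at least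
  \<open>const ^ n * n powr (\<theta> * (m - 1) * n)\<close>. Membership of \<open>g\<close> in the space would bound it by
  \<open>const ^ n * fact n powr s\<close>, at most \<open>const ^ n * n powr (s * n)\<close>. Both cases of the maximum in the
  hypothesis give \<open>s < \<theta> * (m - 1)\<close>, and this is a contradiction for large \<open>n\<close>.

  To make the heuristic rigorous, split off the pure oscillation: near \<open>x\<close>, write
  \<open>g z = exp (\<mu> * (z - x)) * G z\<close> with \<open>\<mu> = \<i> * q' x\<close>. Suppose that on a disc of radius \<open>r\<close> about \<open>x\<close> the
  factor \<open>G\<close> is bounded by a constant times \<open>\<bar>G x\<bar>\<close>. In Leibniz' rule the terms where derivatives fall
  on \<open>G\<close> are then, by Cauchy's inequality, dominated by a geometric series in \<open>n / (r * \<bar>\<mu>\<bar>)\<close>, and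
  \<open>\<mu> ^ n\<close> wins if this quotient is small (\<open>higher_deriv_exp_mult_lower_bound\<close>). The second order
  Taylor remainder of \<open>q\<close> has size \<open>x powr (m - 2) * r\<^sup>2\<close>, so \<open>r\<close> may be taken of order
  \<open>x powr (- (m / 2 - 1))\<close>; with \<open>n = x powr (1 / \<theta>)\<close> the quotient is then of order
  \<open>x powr (1 / \<theta> - m / 2)\<close>. It tends to \<open>0\<close> because the hypotheses force \<open>\<theta> * m > 2\<close>. The same
  inequality makes \<open>f\<close> vary by at most a constant factor on the disc
  (\<open>chirp_bracket_exp_deriv_lower_bound\<close>).
\<close>

section \<open>Derivatives of holomorphic functions\<close>

lemma higher_deriv_on_reals:
  assumes F: "F holomorphic_on S" and S: "open S" and R: "\<And>x. complex_of_real x \<in> S"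
  shows "((\<lambda>g t. vector_derivative g (at t)) ^^ n) (\<lambda>x. F (of_real x))
           = (\<lambda>x. (deriv ^^ n) F (of_real x))" (is ?vec)
    and "(D_op ^^ n) (\<lambda>x. F (of_real x)) = (\<lambda>x. inverse \<i> ^ n * (deriv ^^ n) F (of_real x))" (is ?D)
    and "(\<lambda>x. (deriv ^^ n) F (of_real x)) differentiable (at t)" (is ?diff)
proof -
  have der: "((\<lambda>t. c * (deriv ^^ k) F (of_real t)) has_vector_derivative
               c * (deriv ^^ Suc k) F (of_real x)) (at x)" for c k x
    by (intro has_vector_derivative_real_field DERIV_cmult has_field_derivative_higher_deriv[OF F S R])
  show ?vec
  proof (induction n)
    case (Suc k)
    show ?case
      using vector_derivative_at[OF der[of 1 k]] by (simp add: Suc.IH del: funpow.simps(2)) (simp add: Suc.IH fun_eq_iff)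
  qed simp
  show ?D
  proof (induction n)
    case (Suc k)
    have "(D_op ^^ Suc k) (\<lambda>x. F (of_real x)) = D_op ((D_op ^^ k) (\<lambda>x. F (of_real x)))" by simp
    also have "\<dots> = D_op (\<lambda>x. inverse \<i> ^ k * (deriv ^^ k) F (of_real x))" by (simp only: Suc.IH)
    also have "\<dots> = (\<lambda>x. inverse \<i> ^ Suc k * (deriv ^^ Suc k) F (of_real x))"
      unfolding D_op_def vector_derivative_at[OF der] by (simp add: mult.assoc)
    finally show ?case .
  qed simp
  show ?diff
    using der[of 1 n t] by (simp add: differentiableI_vector)
qed

lemma Cauchy_inequality_cball:
  assumes "F holomorphic_on S" "open S" "cball z r \<subseteq> S" "r > 0"
    and "\<And>w. w \<in> cball z r \<Longrightarrow> norm (F w) \<le> B"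
  shows "norm ((deriv ^^ n) F z) \<le> fact n * B / r ^ n"
proof (rule Cauchy_inequality)
  show "F holomorphic_on ball z r"
    using assms ball_subset_cball by (meson holomorphic_on_subset)
  show "continuous_on (cball z r) F"
    using assms by (meson holomorphic_on_imp_continuous_on holomorphic_on_subset)
qed (use assms in \<open>auto simp: dist_norm\<close>)

text \<open>
  In Leibniz' rule, \<open>n choose k * fact k \<le> n ^ k\<close> and Cauchy's inequality bound the term
  with \<open>k\<close> derivatives on \<open>G\<close>, relative to the leading term \<open>\<mu> ^ n * G z0\<close>, by \<open>B * t ^ k\<close> with
  \<open>t = n / (r * norm \<mu>)\<close>. For \<open>4 * B * t \<le> 1\<close> all terms with \<open>k \<ge> 1\<close> together cancel at most half of
  the leading term.
\<close>

lemma higher_deriv_exp_mult_lower_bound: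
  assumes G: "G holomorphic_on S" and S: "open S" "cball z0 r \<subseteq> S" "r > 0"
    and B: "\<And>z. z \<in> cball z0 r \<Longrightarrow> norm (G z) \<le> B * norm (G z0)"
    and n: "4 * B * real n \<le> r * norm \<mu>" and G0: "G z0 \<noteq> 0"
  shows "norm ((deriv ^^ n) (\<lambda>z. exp (\<mu> * (z - z0)) * G z) z0) \<ge> norm \<mu> ^ n / 2 * norm (G z0)"
proof (cases "n = 0")
  case True
  then show ?thesis by simp
next
  case False
  define g where "g = norm (G z0)"
  have g: "g > 0" using G0 by (simp add: g_def)
  have "g \<le> B * g" using B[of z0] \<open>r > 0\<close> by (simp add: g_def)
  then have B1: "B \<ge> 1" using g by simp
  have mu: "norm \<mu> > 0"
  proof (rule ccontr)
    assume "\<not> norm \<mu> > 0"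
    then have "B * real n \<le> 0" using n by simp
    moreover have "B * real n > 0" using B1 False by simp
    ultimately show False by linarith
  qed
  define t where "t = real n / (r * norm \<mu>)"
  have t0: "t \<ge> 0" using mu \<open>r > 0\<close> by (simp add: t_def)
  have t4: "4 * B * t \<le> 1" using n mu \<open>r > 0\<close> by (simp add: t_def field_simps)
  have t2: "t \<le> 1 / 2"
  proof -
    have "4 * 1 * t \<le> 4 * B * t" using B1 t0 by (intro mult_right_mono) auto
    then show ?thesis using t4 by simp
  qed
  have dexp: "(deriv ^^ k) (\<lambda>z. exp (\<mu> * (z - z0))) = (\<lambda>z. \<mu> ^ k * exp (\<mu> * (z - z0)))" for k
  proof (induction k)
    case (Suc k)
    have "((\<lambda>z. \<mu> ^ k * exp (\<mu> * (z - z0))) has_field_derivative \<mu> ^ Suc k * exp (\<mu> * (z - z0))) (at z)" for z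
      by (auto intro!: derivative_eq_intros)
    from DERIV_imp_deriv[OF this] show ?case by (simp add: Suc.IH fun_eq_iff)
  qed simp
  define T where "T = (\<lambda>i. of_nat (n choose i) * \<mu> ^ i * (deriv ^^ (n - i)) G z0)"
  have "(deriv ^^ n) (\<lambda>z. exp (\<mu> * (z - z0)) * G z) z0 = (\<Sum>i = 0..n. T i)"
    unfolding T_def
    by (subst higher_deriv_mult[OF _ G \<open>open S\<close>])
       (use S in \<open>auto simp: dexp intro!: holomorphic_intros\<close>)
  also have "\<dots> = (\<Sum>i<n. T i) + T n"
    by (simp add: atLeast0AtMost lessThan_Suc_atMost[symmetric])
  finally have eq: "(deriv ^^ n) (\<lambda>z. exp (\<mu> * (z - z0)) * G z) z0 = (\<Sum>i<n. T i) + T n" .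
  have Tn: "norm (T n) = norm \<mu> ^ n * g" by (simp add: T_def norm_mult norm_power g_def)
  have Ti: "norm (T i) \<le> norm \<mu> ^ n * B * g * t ^ (n - i)" if i: "i < n" for i
  proof -
    have "real (n choose i) * fact (n - i) \<le> real n ^ (n - i)"
    proof -
      have "(n choose (n - i)) * fact (n - i) \<le> n ^ (n - i)" by (rule binomial_fact_pow)
      then have "real ((n choose (n - i)) * fact (n - i)) \<le> real (n ^ (n - i))"
        by (rule of_nat_mono)
      then show ?thesis using i by (simp add: binomial_symmetric[of i n])
    qed
    moreover have "norm ((deriv ^^ (n - i)) G z0) \<le> fact (n - i) * (B * g) / r ^ (n - i)"
      by (rule Cauchy_inequality_cball[OF G S]) (use B in \<open>auto simp: g_def\<close>)
    ultimately have "norm (T i) \<le> real (n choose i) * norm \<mu> ^ i * (fact (n - i) * (B * g) / r ^ (n - i))"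
      unfolding T_def norm_mult norm_power by (intro mult_mono) auto
    also have "\<dots> = (real (n choose i) * fact (n - i)) * (norm \<mu> ^ i * (B * g) / r ^ (n - i))"
      by simp
    also have "\<dots> \<le> real n ^ (n - i) * (norm \<mu> ^ i * (B * g) / r ^ (n - i))"
      using \<open>real (n choose i) * fact (n - i) \<le> real n ^ (n - i)\<close> B1 g \<open>r > 0\<close>
      by (intro mult_right_mono) auto
    also have "\<dots> = norm \<mu> ^ n * B * g * t ^ (n - i)"
    proof -
      have "norm \<mu> ^ n = norm \<mu> ^ i * norm \<mu> ^ (n - i)" using i by (simp flip: power_add)
      then show ?thesis using mu by (simp add: t_def power_divide power_mult_distrib)
    qed
    finally show ?thesis .
  qed
  have geo: "(\<Sum>i<n. t ^ (n - i)) \<le> 2 * t"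
  proof -
    have "(\<Sum>i<n. t ^ (n - i)) = (\<Sum>i<n. t ^ Suc i)"
      by (subst sum.nat_diff_reindex[symmetric]) (auto intro!: sum.cong simp: Suc_diff_Suc)
    also have "\<dots> \<le> (\<Sum>i<n. t * (1/2) ^ i)"
      using t0 t2 by (intro sum_mono) (auto intro!: mult_left_mono power_mono)
    also have "\<dots> = t * (\<Sum>i<n. (1/2) ^ i)" by (simp add: sum_distrib_left)
    also have "(\<Sum>i<n. (1/2::real) ^ i) = 2 * (1 - (1/2) ^ n)" by (induction n) (simp_all add: algebra_simps)
    also have "t * (2 * (1 - (1/2) ^ n)) \<le> t * 2" using t0 by (intro mult_left_mono) auto
    finally show ?thesis by simp
  qed
  have "norm (\<Sum>i<n. T i) \<le> (\<Sum>i<n. norm \<mu> ^ n * B * g * t ^ (n - i))"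
    using Ti by (intro sum_norm_le) auto
  also have "\<dots> = norm \<mu> ^ n * B * g * (\<Sum>i<n. t ^ (n - i))" by (simp add: sum_distrib_left)
  also have "\<dots> \<le> norm \<mu> ^ n * B * g * (2 * t)"
    using B1 g geo by (intro mult_left_mono) auto
  also have "\<dots> = norm \<mu> ^ n / 2 * g * (4 * B * t)" by simp
  also have "\<dots> \<le> norm \<mu> ^ n / 2 * g * 1"
    using g t4 by (intro mult_left_mono) auto
  finally have "norm (\<Sum>i<n. T i) \<le> norm \<mu> ^ n / 2 * g" by simp
  then show ?thesis
    unfolding eq g_def[symmetric]
    using Tn norm_diff_ineq[of "T n" "\<Sum>i<n. T i"] by (simp add: add.commute)
qed

section \<open>A holomorphic function with prescribed decay\<close>

text \<open>
  The name refers to the bracket \<open>\<langle>x\<rangle> = sqrt (1 + x\<^sup>2)\<close>: on the real line this is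
  \<open>exp (- (\<langle>x\<rangle> powr (2 * a)))\<close>. The bracket instead of \<open>\<bar>x\<bar>\<close> makes it holomorphic on a strip.
\<close>

definition bracket_exp :: "real \<Rightarrow> complex \<Rightarrow> complex" where
  "bracket_exp a z = exp (- ((1 + z\<^sup>2) powr of_real a))"

lemma open_unit_strip: "open {z. \<bar>Im z\<bar> < 1}"
  by (intro open_Collect_less continuous_intros)

lemma one_plus_square_off_cut:
  assumes "\<bar>Im z\<bar> < 1"
  shows "1 + z\<^sup>2 \<notin> \<real>\<^sub>\<le>\<^sub>0"
proof -
  have "(Im z)\<^sup>2 < 1" using assms by (simp add: abs_square_less_1)
  moreover have "Re (1 + z\<^sup>2) = 1 + (Re z)\<^sup>2 - (Im z)\<^sup>2" by (simp add: power2_eq_square)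
  ultimately have "Re (1 + z\<^sup>2) > 0" by (smt (verit) zero_le_power2)
  then show "1 + z\<^sup>2 \<notin> \<real>\<^sub>\<le>\<^sub>0" by (auto simp: complex_nonpos_Reals_iff)
qed

lemma holomorphic_bracket_exp: "bracket_exp a holomorphic_on {z. \<bar>Im z\<bar> < 1}"
  unfolding bracket_exp_def[abs_def] using one_plus_square_off_cut by (intro holomorphic_intros) auto

lemma bracket_exp_nonzero: "bracket_exp a z \<noteq> 0"
  by (simp add: bracket_exp_def)

lemma bracket_exp_of_real: "bracket_exp a (of_real x) = of_real (exp (- ((1 + x\<^sup>2) powr a)))"
proof -
  have "(1 + (complex_of_real x)\<^sup>2) powr of_real a = of_real ((1 + x\<^sup>2) powr a)"
    using powr_of_real[of "1 + x\<^sup>2" a] by simp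
  then show ?thesis by (simp add: bracket_exp_def exp_of_real flip: of_real_minus)
qed

lemma powr_one_plus_lipschitz:
  obtains K :: real where "K > 0"
    and "\<And>u::complex. norm u \<le> 1/2 \<Longrightarrow> norm ((1 + u) powr of_real a - 1) \<le> K * norm u"
proof -
  define f where "f = (\<lambda>u::complex. (1 + u) powr of_real a)"
  have "1 + u \<notin> \<real>\<^sub>\<le>\<^sub>0" if "u \<in> ball 0 1" for u :: complex
    using that abs_Re_le_cmod[of u] by (auto simp: complex_nonpos_Reals_iff)
  then have hol: "f holomorphic_on ball 0 1" unfolding f_def by (intro holomorphic_intros) auto
  have "continuous_on (cball 0 (1/2)) (deriv f)"
    using holomorphic_on_imp_continuous_on[OF holomorphic_deriv[OF hol]]
    by (rule continuous_on_subset) auto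
  then have "bounded (deriv f ` cball 0 (1/2))"
    by (intro compact_imp_bounded compact_continuous_image) auto
  then obtain K where K: "K > 0" "\<And>u. u \<in> cball 0 (1/2) \<Longrightarrow> norm (deriv f u) \<le> K"
    by (auto simp: bounded_pos)
  show ?thesis
  proof
    fix u :: complex assume u: "norm u \<le> 1/2"
    have "norm (f u - f 0) \<le> K * norm (u - 0)"
    proof (rule field_differentiable_bound)
      show "(f has_field_derivative deriv f z) (at z within cball 0 (1/2))" if "z \<in> cball 0 (1/2)" for z
        using holomorphic_derivI[OF hol, of z] that by (auto intro: has_field_derivative_at_within)
    qed (use u K in auto)
    then show "norm ((1 + u) powr of_real a - 1) \<le> K * norm u" by (simp add: f_def)
  qed fact
qed

text \<open>
  Writing \<open>1 + (x + \<zeta>)\<^sup>2 = w * (1 + u)\<close> with \<open>w = 1 + x\<^sup>2\<close> positive, the power splits into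
  \<open>w powr a * (1 + u) powr a\<close> without branch problems, and \<open>u\<close> has size \<open>norm \<zeta> / sqrt w\<close>. The resulting
  gain of half a power of \<open>w\<close> reflects that differentiating \<open>\<langle>x\<rangle> powr (2 * a)\<close> lowers its order by one.
\<close>

lemma one_plus_square_powr_perturb:
  obtains K :: real where "K > 0"
    and "\<And>x (\<zeta>::complex). norm \<zeta> \<le> 1/6 \<Longrightarrow>
      norm ((1 + (of_real x + \<zeta>)\<^sup>2) powr of_real a - of_real ((1 + x\<^sup>2) powr a))
        \<le> K * norm \<zeta> * (1 + x\<^sup>2) powr (a - 1/2)"
proof -
  obtain L where L: "L > 0" "\<And>u::complex. norm u \<le> 1/2 \<Longrightarrow> norm ((1 + u) powr of_real a - 1) \<le> L * norm u"
    using powr_one_plus_lipschitz by blast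
  show ?thesis
  proof
    show "3 * L > 0" using L by simp
    fix x :: real and \<zeta> :: complex assume z: "norm \<zeta> \<le> 1/6"
    define w where "w = 1 + x\<^sup>2"
    have w: "w \<ge> 1" by (simp add: w_def)
    define u where "u = (2 * of_real x * \<zeta> + \<zeta>\<^sup>2) / of_real w"
    have "complex_of_real w \<noteq> 0" using w by simp
    then have "of_real w * u = 2 * of_real x * \<zeta> + \<zeta>\<^sup>2" by (simp add: u_def)
    then have "of_real w * (1 + u) = of_real w + (2 * of_real x * \<zeta> + \<zeta>\<^sup>2)"
      by (simp only: distrib_left mult_1_right)
    then have split: "1 + (of_real x + \<zeta>)\<^sup>2 = of_real w * (1 + u)"
      by (simp add: w_def power2_eq_square algebra_simps)
    have xw: "\<bar>x\<bar> \<le> w powr (1/2)" using w by (simp add: w_def powr_half_sqrt real_le_rsqrt)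
    have w12: "w powr (1/2) \<ge> 1" using w by (simp add: ge_one_powr_ge_zero)
    have "norm (2 * of_real x * \<zeta> + \<zeta>\<^sup>2) \<le> 2 * \<bar>x\<bar> * norm \<zeta> + norm \<zeta> * norm \<zeta>"
      by (rule order.trans[OF norm_triangle_ineq]) (simp add: norm_mult power2_eq_square)
    also have "\<dots> = (2 * \<bar>x\<bar> + norm \<zeta>) * norm \<zeta>" by (simp add: algebra_simps)
    also have "\<dots> \<le> (3 * w powr (1/2)) * norm \<zeta>"
      using xw w12 z by (intro mult_right_mono) auto
    finally have "norm u \<le> (3 * w powr (1/2)) * norm \<zeta> / w"
      using w by (simp add: u_def norm_divide divide_right_mono)
    also have "\<dots> = 3 * norm \<zeta> * w powr (-1/2)"
      using w powr_diff[of w "1/2" 1] by (simp add: field_simps)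
    finally have u: "norm u \<le> 3 * norm \<zeta> * w powr (-1/2)" .
    have "w powr (-1/2) \<le> w powr 0" using w by (intro powr_mono) auto
    then have "3 * norm \<zeta> * w powr (-1/2) \<le> 3 * (1/6) * 1" using z w by (intro mult_mono) auto
    then have u2: "norm u \<le> 1/2" using u by simp
    have "(1 + (of_real x + \<zeta>)\<^sup>2) powr of_real a - of_real (w powr a)
        = of_real (w powr a) * ((1 + u) powr of_real a - 1)"
      unfolding split using w powr_times_real_left[of "of_real w" "1 + u" "of_real a"]
      by (simp add: powr_of_real algebra_simps)
    then have "norm ((1 + (of_real x + \<zeta>)\<^sup>2) powr of_real a - of_real (w powr a))
        = w powr a * norm ((1 + u) powr of_real a - 1)" by (simp add: norm_mult)
    also have "\<dots> \<le> w powr a * (L * (3 * norm \<zeta> * w powr (-1/2)))"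
      using L(2)[OF u2] u L(1) by (intro mult_left_mono) (auto intro: order.trans mult_left_mono)
    also have "\<dots> = 3 * L * norm \<zeta> * (w powr a * w powr (-1/2))" by simp
    also have "w powr a * w powr (-1/2) = w powr (a - 1/2)" by (simp flip: powr_add)
    finally show "norm ((1 + (of_real x + \<zeta>)\<^sup>2) powr of_real a - of_real ((1 + x\<^sup>2) powr a))
        \<le> 3 * L * norm \<zeta> * (1 + x\<^sup>2) powr (a - 1/2)" by (simp add: w_def)
  qed
qed

text \<open>
  This estimate serves twice: on a disc of small fixed radius it preserves the decay up to a factor in
  the exponent, and on a disc shrinking fast enough with \<open>x\<close> it shows that \<open>bracket_exp a\<close> is comparable to its
  value at the centre.
\<close>

lemma bracket_exp_perturb:
  obtains K :: real where "K > 0"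
    and "\<And>x \<zeta>. norm \<zeta> \<le> 1/6 \<Longrightarrow> norm (bracket_exp a (of_real x + \<zeta>))
      \<le> exp (K * norm \<zeta> * (1 + x\<^sup>2) powr (a - 1/2)) * norm (bracket_exp a (of_real x))"
proof -
  obtain K where K: "K > 0" "\<And>x (\<zeta>::complex). norm \<zeta> \<le> 1/6 \<Longrightarrow>
      norm ((1 + (of_real x + \<zeta>)\<^sup>2) powr of_real a - of_real ((1 + x\<^sup>2) powr a))
        \<le> K * norm \<zeta> * (1 + x\<^sup>2) powr (a - 1/2)"
    using one_plus_square_powr_perturb by blast
  show ?thesis
  proof
    fix x \<zeta> assume "norm (\<zeta>::complex) \<le> 1/6"
    from K(2)[OF this, of x] abs_Re_le_cmod[of "(1 + (of_real x + \<zeta>)\<^sup>2) powr of_real a - of_real ((1 + x\<^sup>2) powr a)"]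
    have "- Re ((1 + (of_real x + \<zeta>)\<^sup>2) powr of_real a)
        \<le> K * norm \<zeta> * (1 + x\<^sup>2) powr (a - 1/2) + - ((1 + x\<^sup>2) powr a)" by simp
    then show "norm (bracket_exp a (of_real x + \<zeta>))
      \<le> exp (K * norm \<zeta> * (1 + x\<^sup>2) powr (a - 1/2)) * norm (bracket_exp a (of_real x))"
      by (simp add: bracket_exp_of_real flip: exp_add) (simp add: bracket_exp_def)
  qed fact
qed

lemma power_le_fact_mult_exp:
  fixes v :: real
  assumes v: "0 \<le> v"
  shows "v ^ n \<le> fact n * exp v"
proof -
  have "(\<Sum>i\<in>{n}. inverse (fact i) * v ^ i) \<le> (\<Sum>i. inverse (fact i) * v ^ i)"
    using v by (intro sum_le_suminf summable_exp) auto
  then have "inverse (fact n) * v ^ n \<le> exp v" by (simp add: exp_def)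
  then show ?thesis by (simp add: field_simps)
qed

text \<open>
  With \<open>u = (1 + x\<^sup>2) powr (1 / (2 * \<theta>))\<close> one has \<open>\<bar>x\<bar> \<le> u powr \<theta>\<close>, so the left-hand side is at most
  the \<open>\<theta>\<close>-th power of \<open>u ^ k * exp (- (u / (2 * \<theta>)))\<close>, to which the exponential series applies.
\<close>

lemma power_mult_exp_decay:
  fixes x \<theta> :: real
  assumes "\<theta> > 0"
  shows "\<bar>x\<bar> ^ k * exp (- ((1 + x\<^sup>2) powr (1 / (2 * \<theta>)) / 2))
           \<le> ((2 * \<theta>) powr \<theta>) ^ k * fact k powr \<theta>"
proof -
  define u where "u = (1 + x\<^sup>2) powr (1 / (2 * \<theta>))"
  have u: "u \<ge> 1" by (simp add: u_def ge_one_powr_ge_zero assms less_imp_le)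
  have "u powr \<theta> = (1 + x\<^sup>2) powr (1/2)" using assms by (simp add: u_def powr_powr)
  then have "\<bar>x\<bar> \<le> u powr \<theta>" by (simp add: powr_half_sqrt real_le_rsqrt)
  then have "\<bar>x\<bar> ^ k \<le> (u powr \<theta>) ^ k" by (intro power_mono) auto
  also have "\<dots> = (u ^ k) powr \<theta>" using u by (simp add: powr_powr mult.commute flip: powr_realpow)
  finally have "\<bar>x\<bar> ^ k * exp (- (u / 2)) \<le> (u ^ k) powr \<theta> * exp (- (u / 2))" by simp
  also have "(u ^ k) powr \<theta> * exp (- (u / 2)) = (u ^ k) powr \<theta> * exp (- (u / (2 * \<theta>))) powr \<theta>"
    using assms by (simp add: exp_powr_real)
  also have "(u ^ k) powr \<theta> * exp (- (u / (2 * \<theta>))) powr \<theta> = (u ^ k * exp (- (u / (2 * \<theta>)))) powr \<theta>"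
    using u by (simp add: powr_mult)
  also have "\<dots> \<le> ((2 * \<theta>) ^ k * fact k) powr \<theta>"
  proof (rule powr_mono2)
    have "(u / (2 * \<theta>)) ^ k \<le> fact k * exp (u / (2 * \<theta>))"
      using u assms by (intro power_le_fact_mult_exp) auto
    then show "u ^ k * exp (- (u / (2 * \<theta>))) \<le> (2 * \<theta>) ^ k * fact k"
      using assms by (simp add: exp_minus field_simps power_divide power_mult_distrib)
  qed (use u assms in auto)
  also have "\<dots> = ((2 * \<theta>) powr \<theta>) ^ k * fact k powr \<theta>"
    using assms by (simp add: powr_mult powr_powr mult.commute flip: powr_realpow)
  finally show ?thesis by (simp add: u_def)
qed

text \<open>
  Cauchy's inequality on discs of a fixed radius turns the decay on a strip into the estimates with
  \<open>s = 1\<close>, which imply those for larger \<open>s\<close>.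
\<close>

lemma bracket_exp_in_gelfand_shilov:
  assumes th: "\<theta> > 0" and s: "s \<ge> 1"
  shows "(\<lambda>x. bracket_exp (1 / (2 * \<theta>)) (of_real x)) \<in> gelfand_shilov \<theta> s"
proof -
  define a where "a = 1 / (2 * \<theta>)"
  define S where "S = {z::complex. \<bar>Im z\<bar> < 1}"
  note hol = holomorphic_bracket_exp[of a, folded S_def] and opS = open_unit_strip[folded S_def]
  have R: "complex_of_real x \<in> S" for x by (simp add: S_def)
  obtain K where K: "K > 0" "\<And>x \<zeta>. norm \<zeta> \<le> 1/6 \<Longrightarrow> norm (bracket_exp a (of_real x + \<zeta>))
      \<le> exp (K * norm \<zeta> * (1 + x\<^sup>2) powr (a - 1/2)) * norm (bracket_exp a (of_real x))"
    using bracket_exp_perturb by blast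
  define r where "r = min (1/6) (1 / (2 * K))"
  have r: "r > 0" "r \<le> 1/6" "K * r \<le> 1/2" using K(1) by (auto simp: r_def min_def field_simps)
  have Fbd: "norm (bracket_exp a z) \<le> exp (- ((1 + x\<^sup>2) powr a / 2))" if z: "z \<in> cball (of_real x) r" for x z
  proof -
    define \<zeta> where "\<zeta> = z - of_real x"
    have n: "norm \<zeta> \<le> r" using z by (simp add: \<zeta>_def dist_norm norm_minus_commute)
    have *: "K * norm \<zeta> * (1 + x\<^sup>2) powr (a - 1/2) \<le> 1/2 * (1 + x\<^sup>2) powr a"
    proof (intro mult_mono)
      show "K * norm \<zeta> \<le> 1/2" using n r K(1) by (meson mult_left_mono less_imp_le order.trans)
      show "(1 + x\<^sup>2) powr (a - 1/2) \<le> (1 + x\<^sup>2) powr a" by (intro powr_mono) auto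
    qed (use K in auto)
    have "norm (bracket_exp a (of_real x + \<zeta>))
      \<le> exp (K * norm \<zeta> * (1 + x\<^sup>2) powr (a - 1/2)) * exp (- ((1 + x\<^sup>2) powr a))"
      using K(2)[of \<zeta> x] n r by (simp add: bracket_exp_of_real)
    also have "\<dots> = exp (K * norm \<zeta> * (1 + x\<^sup>2) powr (a - 1/2) - (1 + x\<^sup>2) powr a)"
      by (simp flip: exp_add)
    also have "\<dots> \<le> exp (- ((1 + x\<^sup>2) powr a / 2))" using * by simp
    finally show ?thesis by (simp add: \<zeta>_def)
  qed
  have dbd: "norm ((deriv ^^ n) (bracket_exp a) (of_real x)) \<le> fact n * exp (- ((1 + x\<^sup>2) powr a / 2)) / r ^ n" for n x
  proof (rule Cauchy_inequality_cball[OF hol opS _ r(1) Fbd])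
    show "cball (complex_of_real x) r \<subseteq> S"
    proof
      fix z assume "z \<in> cball (complex_of_real x) r"
      then have "\<bar>Im (of_real x - z)\<bar> \<le> r" using abs_Im_le_cmod[of "of_real x - z"] by (simp add: dist_norm)
      then show "z \<in> S" using r by (simp add: S_def)
    qed
  qed
  define h where "h = max (1 / r) ((2 * \<theta>) powr \<theta>)"
  have h: "h > 0" "1 / r \<le> h" "(2 * \<theta>) powr \<theta> \<le> h" using r(1) by (auto simp: h_def less_max_iff_disj)
  have bound: "cmod (complex_of_real (x ^ \<alpha>) * (D_op ^^ \<beta>) (\<lambda>x. bracket_exp a (of_real x)) x)
                  / (h ^ (\<alpha> + \<beta>) * (fact \<alpha>) powr \<theta> * (fact \<beta>) powr s) \<le> 1" for \<alpha> \<beta> x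
  proof -
    have "cmod (complex_of_real (x ^ \<alpha>) * (D_op ^^ \<beta>) (\<lambda>x. bracket_exp a (of_real x)) x)
        = \<bar>x\<bar> ^ \<alpha> * norm ((deriv ^^ \<beta>) (bracket_exp a) (of_real x))"
      by (simp add: higher_deriv_on_reals(2)[OF hol opS R] norm_mult norm_power norm_inverse)
    also have "\<dots> \<le> \<bar>x\<bar> ^ \<alpha> * (fact \<beta> * exp (- ((1 + x\<^sup>2) powr a / 2)) / r ^ \<beta>)"
      using dbd by (intro mult_left_mono) auto
    also have "\<dots> = (\<bar>x\<bar> ^ \<alpha> * exp (- ((1 + x\<^sup>2) powr a / 2))) * (1 / r) ^ \<beta> * fact \<beta>"
      by (simp add: power_divide)
    also have "\<dots> \<le> (((2 * \<theta>) powr \<theta>) ^ \<alpha> * fact \<alpha> powr \<theta>) * h ^ \<beta> * fact \<beta> powr s"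
    proof (rule mult_mono[OF mult_mono])
      show "\<bar>x\<bar> ^ \<alpha> * exp (- ((1 + x\<^sup>2) powr a / 2)) \<le> ((2 * \<theta>) powr \<theta>) ^ \<alpha> * fact \<alpha> powr \<theta>"
        unfolding a_def by (rule power_mult_exp_decay[OF th])
      show "(1 / r) ^ \<beta> \<le> h ^ \<beta>" using h(2) r(1) by (intro power_mono) auto
      have "(fact \<beta> :: real) powr 1 \<le> fact \<beta> powr s" using s by (intro powr_mono) (auto simp: fact_ge_1)
      then show "(fact \<beta> :: real) \<le> fact \<beta> powr s" by simp
    qed (use h r in auto)
    also have "\<dots> \<le> h ^ \<alpha> * fact \<alpha> powr \<theta> * h ^ \<beta> * fact \<beta> powr s"
      using h by (intro mult_right_mono power_mono) auto
    finally show ?thesis using h by (simp add: power_add divide_le_eq_1 algebra_simps)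
  qed
  have smooth: "smooth_fun (\<lambda>x. bracket_exp a (of_real x))"
    unfolding smooth_fun_def higher_deriv_on_reals(1)[OF hol opS R]
    using higher_deriv_on_reals(3)[OF hol opS R] by blast
  have "(\<lambda>x. bracket_exp a (of_real x)) \<in> gelfand_shilov_h \<theta> s h"
    unfolding gelfand_shilov_h_def
  proof (intro CollectI conjI smooth bdd_aboveI[where M = 1])
    fix y
    assume "y \<in> {cmod (complex_of_real (x ^ \<alpha>) * (D_op ^^ \<beta>) (\<lambda>x. bracket_exp a (of_real x)) x)
        / (h ^ (\<alpha> + \<beta>) * (fact \<alpha>) powr \<theta> * (fact \<beta>) powr s) | \<alpha> \<beta> x. True}"
    then show "y \<le> 1" using bound by (elim CollectE exE conjE) simp
  qed
  then show ?thesis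
    unfolding gelfand_shilov_def a_def[symmetric] using h(1) by (intro UN_I[of h]) auto
qed

section \<open>Growth of polynomials\<close>

lemma poly_growth:
  fixes p :: "complex poly"
  obtains A where "A \<ge> 0"
    and "\<And>X w. X \<ge> 1 \<Longrightarrow> norm w \<le> X \<Longrightarrow> norm (poly p w) \<le> A * X ^ degree p"
proof (rule that)
  show "(\<Sum>i\<le>degree p. norm (coeff p i)) \<ge> 0" by (simp add: sum_nonneg)
  fix X :: real and w :: complex assume X: "X \<ge> 1" "norm w \<le> X"
  have "norm (poly p w) \<le> (\<Sum>i\<le>degree p. norm (coeff p i) * X ^ degree p)"
    unfolding poly_altdef
  proof (rule sum_norm_le)
    fix i assume i: "i \<in> {..degree p}"
    have "norm w ^ i \<le> X ^ i" using X by (intro power_mono) auto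
    also have "\<dots> \<le> X ^ degree p" using X i by (intro power_increasing) auto
    finally show "norm (coeff p i * w ^ i) \<le> norm (coeff p i) * X ^ degree p"
      by (simp add: norm_mult norm_power mult_left_mono)
  qed
  then show "norm (poly p w) \<le> (\<Sum>i\<le>degree p. norm (coeff p i)) * X ^ degree p"
    by (simp add: sum_distrib_right)
qed

lemma poly_lower_bound_at_infinity:
  fixes p :: "complex poly"
  assumes "p \<noteq> 0"
  obtains c M :: real where "c > 0" and "\<And>w. norm (w::complex) \<ge> M \<Longrightarrow> c * norm w ^ degree p \<le> norm (poly p w)"
proof (cases "degree p")
  case 0
  then obtain k where "p = [:k:]" by (metis degree_eq_zeroE)
  then show ?thesis using that[of "norm k" 0] assms by simp
next
  case (Suc d)
  define l where "l = norm (lead_coeff p)"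
  have l: "l > 0" using assms by (simp add: l_def)
  obtain M where M: "\<And>z. M \<le> norm z \<Longrightarrow> norm (\<Sum>i\<le>d. coeff p i * z ^ i) \<le> l / 2 * norm z ^ Suc d"
    using polyfun_extremal_lemma[of "l / 2" "coeff p" d] l by auto
  show ?thesis
  proof (rule that)
    show "l / 2 > 0" using l by simp
    fix w :: complex assume w: "norm w \<ge> M"
    have "poly p w = lead_coeff p * w ^ Suc d + (\<Sum>i\<le>d. coeff p i * w ^ i)"
      by (simp add: poly_altdef Suc)
    moreover have "norm (lead_coeff p * w ^ Suc d) = l * norm w ^ Suc d"
      by (simp add: l_def norm_mult norm_power)
    ultimately show "l / 2 * norm w ^ degree p \<le> norm (poly p w)"
      using M[OF w] norm_diff_ineq[of "lead_coeff p * w ^ Suc d" "\<Sum>i\<le>d. coeff p i * w ^ i"]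
      by (simp add: Suc)
  qed
qed

text \<open>
  Taylor's formula: on the unit disc about \<open>x\<close> all points have norm at most \<open>2 * norm x\<close>, which controls
  the second derivative.
\<close>

lemma poly_second_order_remainder:
  fixes p :: "complex poly"
  obtains A where "A \<ge> 0"
    and "\<And>x z. norm x \<ge> 1 \<Longrightarrow> norm (z - x) \<le> 1 \<Longrightarrow>
      norm (poly p z - poly p x - poly (pderiv p) x * (z - x)) \<le> A * norm x ^ (degree p - 2) * norm (z - x) ^ 2"
proof -
  obtain A where A: "A \<ge> 0" "\<And>X w. X \<ge> 1 \<Longrightarrow> norm w \<le> X \<Longrightarrow>
      norm (poly (pderiv (pderiv p)) w) \<le> A * X ^ degree (pderiv (pderiv p))"
    using poly_growth[of "pderiv (pderiv p)"] by blast
  have deg: "degree (pderiv (pderiv p)) = degree p - 2" by (simp add: degree_pderiv)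
  show ?thesis
  proof
    show "A * 2 ^ (degree p - 2) \<ge> 0" using A by simp
    fix x z :: complex assume x: "norm x \<ge> 1" and z: "norm (z - x) \<le> 1"
    define f where "f = (\<lambda>i. poly ((pderiv ^^ i) p))"
    have "norm (f 0 z - (\<Sum>i\<le>1. f i x * (z - x) ^ i / fact i))
        \<le> (A * (2 * norm x) ^ (degree p - 2)) * norm (z - x) ^ Suc 1 / fact 1"
    proof (rule complex_Taylor)
      show "convex (cball x 1)" by (rule convex_cball)
      show "(f i has_field_derivative f (Suc i) w) (at w within cball x 1)" for i w
        unfolding f_def by (auto intro!: has_field_derivative_at_within poly_DERIV)
      show "norm (f (Suc 1) w) \<le> A * (2 * norm x) ^ (degree p - 2)" if "w \<in> cball x 1" for w
      proof -
        have "norm w \<le> norm x + norm (w - x)" by (metis norm_triangle_sub)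
        also have "\<dots> \<le> 2 * norm x" using that x by (simp add: dist_norm norm_minus_commute)
        finally show ?thesis using A(2)[of "2 * norm x" w] x by (simp add: f_def deg numeral_2_eq_2)
      qed
    qed (use z in \<open>auto simp: dist_norm norm_minus_commute\<close>)
    then show "norm (poly p z - poly p x - poly (pderiv p) x * (z - x))
        \<le> A * 2 ^ (degree p - 2) * norm x ^ (degree p - 2) * norm (z - x) ^ 2"
      by (simp add: f_def power_mult_distrib power2_eq_square algebra_simps)
  qed
qed

section \<open>Large derivatives of the chirped function\<close>

text \<open>
  The disc has radius \<open>r = x powr (- \<delta>) / 6\<close> with \<open>\<delta> = m / 2 - 1\<close>, where \<open>m = degree p\<close>. This is small
  enough for the nonlinear part of \<open>p\<close> to stay bounded, since \<open>x powr (m - 2) * r\<^sup>2\<close> is bounded, and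
  for \<open>bracket_exp a\<close> to stay comparable to its value at \<open>x\<close>, since the exponent \<open>2 * a - 1\<close> in
  \<open>bracket_exp_perturb\<close> is at most \<open>\<delta>\<close>. It is large enough for \<open>n / (r * norm \<mu>)\<close> to tend to \<open>0\<close> when
  \<open>n \<le> x powr (1 / \<theta>)\<close>, since \<open>r * norm \<mu>\<close> grows like \<open>x powr (m / 2)\<close>.
\<close>

lemma chirp_bracket_exp_deriv_lower_bound:
  fixes p :: "complex poly" and \<theta> :: real
  assumes m: "degree p \<ge> 2" and th: "\<theta> > 0" and tm: "\<theta> * degree p > 2"
  defines "a \<equiv> 1 / (2 * \<theta>)"
  obtains c where "c > 0"
    and "eventually (\<lambda>x::real. \<forall>n. real n \<le> x powr (1 / \<theta>) \<longrightarrow>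
      norm ((deriv ^^ n) (\<lambda>z. exp (\<i> * poly p z) * bracket_exp a z) (of_real x))
        \<ge> (c * x ^ (degree p - 1)) ^ n / 2 * norm (exp (\<i> * poly p (of_real x)) * bracket_exp a (of_real x))) at_top"
proof -
  define m where "m = degree p"
  define \<delta> where "\<delta> = real m / 2 - 1"
  have m2: "m \<ge> 2" and d0: "\<delta> \<ge> 0" using m by (auto simp: m_def \<delta>_def)
  have da: "2 * a - 1 \<le> \<delta>" using th tm by (simp add: a_def \<delta>_def m_def field_simps)
  define S where "S = {z::complex. \<bar>Im z\<bar> < 1}"
  note hol = holomorphic_bracket_exp[of a, folded S_def] and opS = open_unit_strip[folded S_def]
  obtain K where K: "K > 0" "\<And>x \<zeta>. norm \<zeta> \<le> 1/6 \<Longrightarrow> norm (bracket_exp a (of_real x + \<zeta>))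
      \<le> exp (K * norm \<zeta> * (1 + x\<^sup>2) powr (a - 1/2)) * norm (bracket_exp a (of_real x))"
    using bracket_exp_perturb by blast
  obtain A where A: "A \<ge> 0" "\<And>x z. norm x \<ge> 1 \<Longrightarrow> norm (z - x) \<le> 1 \<Longrightarrow>
      norm (poly p z - poly p x - poly (pderiv p) x * (z - x)) \<le> A * norm x ^ (m - 2) * norm (z - x) ^ 2"
    using poly_second_order_remainder[of p] unfolding m_def by blast
  have "pderiv p \<noteq> 0" using m by (simp add: pderiv_eq_0_iff)
  then obtain c M where c: "c > 0" "\<And>w. norm (w::complex) \<ge> M \<Longrightarrow> c * norm w ^ (m - 1) \<le> norm (poly (pderiv p) w)"
    using poly_lower_bound_at_infinity[of "pderiv p"] by (auto simp: degree_pderiv m_def)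
  define B where "B = exp (A + K * 2 powr (\<delta> / 2))"
  have B: "B > 0" by (simp add: B_def)
  have "((\<lambda>x. x powr (1 / \<theta> - real m / 2)) \<longlongrightarrow> 0) at_top"
    using tm th by (intro tendsto_neg_powr filterlim_ident) (simp add: m_def field_simps)
  \<comment> \<open>\<open>24 = 4 * 6\<close>: the factor \<open>4\<close> required by \<open>higher_deriv_exp_mult_lower_bound\<close> and the \<open>6\<close> in the radius.\<close>
  then have ev0: "eventually (\<lambda>x. x powr (1 / \<theta> - real m / 2) < c / (24 * B)) at_top"
    using c B by (intro order_tendstoD) auto
  have "eventually (\<lambda>x::real. \<forall>n. real n \<le> x powr (1 / \<theta>) \<longrightarrow>
      norm ((deriv ^^ n) (\<lambda>z. exp (\<i> * poly p z) * bracket_exp a z) (of_real x))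
        \<ge> (c * x ^ (m - 1)) ^ n / 2 * norm (exp (\<i> * poly p (of_real x)) * bracket_exp a (of_real x))) at_top"
    using ev0 eventually_ge_at_top[of "max 1 M"]
  proof eventually_elim
    case (elim x)
    then have x: "x \<ge> 1" "x \<ge> M" by auto
    define r where "r = x powr (- \<delta>) / 6"
    define \<mu> where "\<mu> = \<i> * poly (pderiv p) (of_real x)"
    define G where "G = (\<lambda>z. exp (\<i> * poly p z - \<mu> * (z - of_real x)) * bracket_exp a z)"
    have "x powr (- \<delta>) \<le> x powr 0" using x d0 by (intro powr_mono) auto
    then have r: "r > 0" "r \<le> 1/6" using x by (auto simp: r_def)
    have mu: "norm \<mu> \<ge> c * x ^ (m - 1)" using c(2)[of "of_real x"] x by (simp add: \<mu>_def norm_mult)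
    have nG: "norm (G (of_real x)) = norm (exp (\<i> * poly p (of_real x)) * bracket_exp a (of_real x))"
      by (simp add: G_def)
    \<comment> \<open>The linear part of the phase is the pure oscillation; \<open>G\<close> keeps the rest.\<close>
    have E: "(\<lambda>z. exp (\<i> * poly p z) * bracket_exp a z) = (\<lambda>z. exp (\<mu> * (z - of_real x)) * G z)"
      by (simp add: G_def fun_eq_iff flip: exp_add)
    have G: "norm (G z) \<le> B * norm (G (of_real x))" if z: "z \<in> cball (of_real x) r" for z
    proof -
      define \<zeta> where "\<zeta> = z - of_real x"
      have n: "norm \<zeta> \<le> r" using z by (simp add: \<zeta>_def dist_norm norm_minus_commute)
      define R where "R = poly p z - poly p (of_real x) - poly (pderiv p) (of_real x) * \<zeta>"
      have "norm R \<le> A * x ^ (m - 2) * norm \<zeta> ^ 2"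
        using A(2)[of "of_real x" z] x n r by (simp add: R_def \<zeta>_def)
      also have "\<dots> \<le> A * x ^ (m - 2) * r ^ 2"
        using A x n by (intro mult_left_mono power_mono) auto
      also have "\<dots> = A / 36 * (x powr real (m - 2) * (x powr (- \<delta>)) ^ 2)"
        using x by (simp add: r_def power_divide powr_realpow)
      also have "(x powr (- \<delta>)) ^ 2 = x powr (- real (m - 2))"
        using x m2 by (simp add: power2_eq_square \<delta>_def of_nat_diff flip: powr_add)
      also have "A / 36 * (x powr real (m - 2) * x powr (- real (m - 2))) \<le> A"
        using x A by (simp flip: powr_add)
      finally have R: "norm R \<le> A" .
      have "(1 + x\<^sup>2) powr (a - 1/2) \<le> (1 + x\<^sup>2) powr (\<delta> / 2)" using da by (intro powr_mono) auto
      also have "\<dots> \<le> (2 * x\<^sup>2) powr (\<delta> / 2)" using x d0 by (intro powr_mono2) auto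
      also have "\<dots> = 2 powr (\<delta> / 2) * x powr \<delta>"
        using x by (simp add: powr_mult powr_powr flip: powr_numeral)
      finally have w: "(1 + x\<^sup>2) powr (a - 1/2) \<le> 2 powr (\<delta> / 2) * x powr \<delta>" .
      have "K * norm \<zeta> * (1 + x\<^sup>2) powr (a - 1/2) \<le> K * r * (2 powr (\<delta> / 2) * x powr \<delta>)"
        using w n K r by (intro mult_mono mult_left_mono) auto
      also have "\<dots> = K * 2 powr (\<delta> / 2) / 6 * (x powr (- \<delta>) * x powr \<delta>)" by (simp add: r_def)
      also have "\<dots> \<le> K * 2 powr (\<delta> / 2)" using x K by (simp flip: powr_add)
      finally have e: "K * norm \<zeta> * (1 + x\<^sup>2) powr (a - 1/2) \<le> K * 2 powr (\<delta> / 2)" .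
      have "norm (exp (\<i> * poly p z - \<mu> * \<zeta>)) = norm (exp (\<i> * poly p (of_real x))) * norm (exp (\<i> * R))"
        by (simp add: R_def \<mu>_def algebra_simps flip: norm_mult exp_add)
      also have "\<dots> \<le> norm (exp (\<i> * poly p (of_real x))) * exp A"
        using norm_exp[of "\<i> * R"] R by (intro mult_left_mono) (auto simp: norm_mult intro: order.trans)
      finally have 1: "norm (exp (\<i> * poly p z - \<mu> * \<zeta>)) \<le> norm (exp (\<i> * poly p (of_real x))) * exp A" .
      have "norm (bracket_exp a z) \<le> exp (K * norm \<zeta> * (1 + x\<^sup>2) powr (a - 1/2)) * norm (bracket_exp a (of_real x))"
        using K(2)[of \<zeta> x] n r by (simp add: \<zeta>_def)
      also have "\<dots> \<le> exp (K * 2 powr (\<delta> / 2)) * norm (bracket_exp a (of_real x))"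
        using e by (intro mult_right_mono) auto
      finally have 2: "norm (bracket_exp a z) \<le> exp (K * 2 powr (\<delta> / 2)) * norm (bracket_exp a (of_real x))" .
      have "norm (G z) \<le> (norm (exp (\<i> * poly p (of_real x))) * exp A) * (exp (K * 2 powr (\<delta> / 2)) * norm (bracket_exp a (of_real x)))"
        unfolding G_def norm_mult \<zeta>_def[symmetric] using 1 2 by (intro mult_mono) auto
      also have "\<dots> = B * norm (G (of_real x))" by (simp add: nG B_def exp_add norm_mult)
      finally show ?thesis .
    qed
    have sub: "cball (complex_of_real x) r \<subseteq> S"
    proof
      fix z assume "z \<in> cball (complex_of_real x) r"
      then have "\<bar>Im (of_real x - z)\<bar> \<le> r" using abs_Im_le_cmod[of "of_real x - z"] by (simp add: dist_norm)
      then show "z \<in> S" using r by (simp add: S_def)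
    qed
    have holG: "G holomorphic_on S" unfolding G_def by (intro holomorphic_intros hol)
    show ?case
    proof (intro allI impI)
      fix n :: nat assume n: "real n \<le> x powr (1 / \<theta>)"
      have "4 * B * real n \<le> 4 * B * x powr (1 / \<theta>)" using n B by simp
      also have "\<dots> = 4 * B * x powr (1 / \<theta> - real m / 2) * x powr (real m / 2)"
        by (simp flip: powr_add)
      also have "\<dots> \<le> 4 * B * (c / (24 * B)) * x powr (real m / 2)"
        using elim(1) B c(1) by (intro mult_mono mult_left_mono) auto
      also have "\<dots> = c / 6 * x powr (- \<delta> + real (m - 1))"
        using B m2 by (simp add: \<delta>_def of_nat_diff)
      also have "\<dots> = r * (c * x ^ (m - 1))"
        using x powr_add[of x "- \<delta>" "real (m - 1)"] powr_realpow[of x "m - 1"] by (simp add: r_def)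
      also have "\<dots> \<le> r * norm \<mu>" using mu r by simp
      finally have "4 * B * real n \<le> r * norm \<mu>" .
      from higher_deriv_exp_mult_lower_bound[OF holG opS sub r(1) G this]
      have "norm \<mu> ^ n / 2 * norm (G (of_real x))
          \<le> norm ((deriv ^^ n) (\<lambda>z. exp (\<i> * poly p z) * bracket_exp a z) (of_real x))"
        by (simp add: E G_def bracket_exp_nonzero)
      moreover have "(c * x ^ (m - 1)) ^ n / 2 * norm (G (of_real x)) \<le> norm \<mu> ^ n / 2 * norm (G (of_real x))"
        using mu x c by (intro mult_right_mono divide_right_mono power_mono) auto
      ultimately show "(c * x ^ (m - 1)) ^ n / 2 * norm (exp (\<i> * poly p (of_real x)) * bracket_exp a (of_real x))
          \<le> norm ((deriv ^^ n) (\<lambda>z. exp (\<i> * poly p z) * bracket_exp a z) (of_real x))"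
        unfolding nG by linarith
    qed
  qed
  then show ?thesis using that c(1) unfolding m_def by blast
qed

section \<open>Chirps do not preserve the Gelfand-Shilov space\<close>

theorem theorem1p2:
  fixes q :: "real poly" and m :: nat and s \<theta> :: real
  assumes "degree q = m" and "m \<ge> 2"
    and "s > 0" and "\<theta> > 0"
    and "1 \<le> s" and "s < \<theta> * real m - max \<theta> 1"
    and "m = 3 \<Longrightarrow> \<theta> \<ge> 1"
  shows "\<not> chirp_op q ` gelfand_shilov \<theta> s \<subseteq> gelfand_shilov \<theta> s"
proof
  assume T: "chirp_op q ` gelfand_shilov \<theta> s \<subseteq> gelfand_shilov \<theta> s"
  define a where "a = 1 / (2 * \<theta>)"
  define p where "p = map_poly complex_of_real q"
  have deg: "degree p = m" using assms(1) by (simp add: p_def degree_map_poly)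
  have pq: "poly p (of_real x) = of_real (poly q x)" for x
    unfolding p_def by (induction q) (auto simp: map_poly_pCons)
  define g where "g = (\<lambda>z. exp (\<i> * poly p z) * bracket_exp a z)"
  define S where "S = {z::complex. \<bar>Im z\<bar> < 1}"
  have hol: "g holomorphic_on S"
    unfolding g_def by (intro holomorphic_intros holomorphic_bracket_exp[of a, folded S_def])
  have opS: "open S" using open_unit_strip by (simp add: S_def)
  have R: "complex_of_real x \<in> S" for x by (simp add: S_def)
  have "chirp_op q (\<lambda>x. bracket_exp a (of_real x)) = (\<lambda>x. g (of_real x))"
    by (simp add: chirp_op_def g_def pq)
  moreover have "(\<lambda>x. bracket_exp a (of_real x)) \<in> gelfand_shilov \<theta> s"
    unfolding a_def using assms by (intro bracket_exp_in_gelfand_shilov)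
  ultimately have "(\<lambda>x. g (of_real x)) \<in> gelfand_shilov \<theta> s" using T by (metis image_subset_iff)
  then obtain h C where h: "h > 0"
    and "\<And>\<alpha> \<beta> x. cmod (complex_of_real (x ^ \<alpha>) * (D_op ^^ \<beta>) (\<lambda>x. g (of_real x)) x)
                  / (h ^ (\<alpha> + \<beta>) * (fact \<alpha>) powr \<theta> * (fact \<beta>) powr s) \<le> C"
    unfolding gelfand_shilov_def gelfand_shilov_h_def bdd_above_def by blast
  from this(2)[where \<alpha> = 0]
  have up: "norm ((deriv ^^ n) g (of_real x)) \<le> C * (h ^ n * fact n powr s)" for n x
    using h by (simp add: higher_deriv_on_reals(2)[OF hol opS R] norm_mult norm_power norm_inverse divide_le_eq)
  have tm: "\<theta> * real m > 2" using assms(5,6) by (auto simp: max_def split: if_splits)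
  obtain c where c: "c > 0" and low: "eventually (\<lambda>x::real. \<forall>n. real n \<le> x powr (1 / \<theta>) \<longrightarrow>
      norm ((deriv ^^ n) g (of_real x))
        \<ge> (c * x ^ (m - 1)) ^ n / 2 * norm (exp (\<i> * poly p (of_real x)) * bracket_exp a (of_real x))) at_top"
    using chirp_bracket_exp_deriv_lower_bound[of p \<theta>] assms(2,4) tm unfolding g_def a_def deg by blast
  define b where "b = \<theta> * real (m - 1) - s"
  have b: "b > 0" using assms(2,6) by (auto simp: b_def of_nat_diff max_def algebra_simps split: if_splits)
  define \<kappa> where "\<kappa> = (2::real) powr a"
  have a0: "a > 0" using assms by (simp add: a_def)
  have lim: "filterlim (\<lambda>n. real n powr t) at_top sequentially" if "t > 0" for t
    using filterlim_compose[OF real_powr_at_top[OF that] filterlim_real_sequentially] .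
  \<comment> \<open>This makes the base \<open>c * x ^ (m - 1)\<close>, after paying \<open>exp \<kappa>\<close> for the decay, at least twice the base
    \<open>h * n powr s\<close> of the upper bound, so that the quotient of the bounds grows like \<open>2 ^ n\<close>.\<close>
  have ev1: "eventually (\<lambda>n. real n powr b \<ge> 2 * h * exp \<kappa> / c) sequentially"
    using lim[OF b] by (auto simp: filterlim_at_top)
  have ev2: "eventually (\<lambda>n. (2::real) ^ n > 2 * C) sequentially"
  proof -
    have "filterlim (\<lambda>n. (2::real) ^ n) at_top sequentially"
      by real_asymp
    then show ?thesis by (auto simp: filterlim_at_top_dense)
  qed
  have "eventually (\<lambda>n::nat. False) sequentially"
    using ev1 ev2 eventually_compose_filterlim[OF low lim[OF assms(4)]] eventually_ge_at_top[of 1]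
  proof eventually_elim
    case (elim n)
    define x where "x = real n powr \<theta>"
    have n: "real n \<ge> 1" using elim(4) by simp
    have x: "x \<ge> 1" using n assms(4) by (simp add: x_def ge_one_powr_ge_zero)
    have xn: "x powr (1 / \<theta>) = real n" using assms(4) n by (simp add: x_def powr_powr)
    have "(1 + x\<^sup>2) powr a \<le> (2 * x\<^sup>2) powr a" using x a0 by (intro powr_mono2) auto
    also have "\<dots> = \<kappa> * real n"
      using x n assms(4) by (simp add: \<kappa>_def powr_mult x_def powr_powr a_def flip: powr_numeral)
    finally have dec: "norm (exp (\<i> * poly p (of_real x)) * bracket_exp a (of_real x)) \<ge> exp (- (\<kappa> * real n))"
      by (simp add: norm_mult pq bracket_exp_of_real)
    have xm: "x ^ (m - 1) = real n powr b * real n powr s"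
      using n by (simp add: x_def b_def powr_powr flip: powr_add powr_realpow)
    have fact_bound: "(fact n :: real) powr s \<le> (real n powr s) ^ n"
    proof -
      have "(fact n :: real) powr s \<le> (real n ^ n) powr s"
        using fact_le_power[of n, where 'a = real] assms(3) by (intro powr_mono2) auto
      also have "\<dots> = (real n powr s) ^ n" using n by (simp add: powr_powr mult.commute flip: powr_realpow)
      finally show ?thesis .
    qed
    have "c * x ^ (m - 1) \<ge> 2 * h * exp \<kappa> * real n powr s"
      using elim(1) c n unfolding xm by (simp add: field_simps mult_left_mono)
    then have "(2 * h * exp \<kappa> * real n powr s) ^ n \<le> (c * x ^ (m - 1)) ^ n"
      using h by (intro power_mono) auto
    then have "(2 * h * exp \<kappa> * real n powr s) ^ n / 2 * exp (- (\<kappa> * real n))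
        \<le> (c * x ^ (m - 1)) ^ n / 2 * norm (exp (\<i> * poly p (of_real x)) * bracket_exp a (of_real x))"
      using dec c x by (intro mult_mono divide_right_mono) auto
    also have "\<dots> \<le> norm ((deriv ^^ n) g (of_real x))"
      using elim(3) xn by (simp add: x_def)
    also have "\<dots> \<le> C * (h ^ n * fact n powr s)" by (rule up)
    also have "\<dots> \<le> C * (h ^ n * (real n powr s) ^ n)"
    proof -
      have "0 \<le> C * (h ^ 0 * fact 0 powr s)" using up[of 0 0] norm_ge_zero order.trans by blast
      then show ?thesis using fact_bound h by (intro mult_left_mono) auto
    qed
    also have "(2 * h * exp \<kappa> * real n powr s) ^ n / 2 * exp (- (\<kappa> * real n))
        = 2 ^ n / 2 * (h ^ n * (real n powr s) ^ n) * (exp \<kappa> ^ n * exp (- (\<kappa> * real n)))"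
      unfolding power_mult_distrib by (simp only: mult.assoc times_divide_eq_left times_divide_eq_right ac_simps)
    also have "exp \<kappa> ^ n * exp (- (\<kappa> * real n)) = 1"
      by (simp flip: exp_of_nat2_mult exp_add)
    finally have "2 ^ n / 2 * (h ^ n * (real n powr s) ^ n) \<le> C * (h ^ n * (real n powr s) ^ n)"
      by (simp only: mult_1_right ac_simps)
    moreover have "h ^ n * (real n powr s) ^ n > 0" using h n by simp
    ultimately have "2 ^ n / 2 \<le> C" by (rule mult_right_le_imp_le)
    with elim(2) show False by simp
  qed
  then show False by simp
qed

end
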